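(* Let $G$ be a finite simple undirected graph with vertex set $V$, $|V|=n$, edge set $E$, $|E|=m\ge 1$, and vertex degrees $d_i$ ($i\in V$), and let $q$ be the largest eigenvalue of its signless Laplacian. Put $$\nu=\frac{n\sum_{i\in V}d_i^2}{4m^2},\qquad \epsilon=\frac{n\sum_{ij\in E}\sqrt{d_id_j}}{2m^2},\qquad \gamma=\frac{qn}{4m}.$$ Then $\nu\ge\epsilon$ and $\gamma\ge\nu$.
   Context: The signless Laplacian of $G$ is the matrix $D+A$, where $A$ is the adjacency matrix of $G$ and $D$ is the diagonal matrix of vertex degrees. Sums over $ij\in E$ run over each (unordered) edge once. The quantities $\nu,\epsilon,\gamma$ are measures of irregularity of $G$, defined for graphs with at least one edge. *)

theory Defs
  imports "HOL-Analysis.Analysis"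
begin

text \<open>The vertex set is a finite type \<open>'v\<close>, so that \<open>n = CARD('v)\<close> and matrices indexed by
  vertices are elements of \<open>real ^ 'v ^ 'v\<close>. An edge is a two-element set of vertices.\<close>

definition simple_graph :: "'v::finite set set \<Rightarrow> bool" where
  "simple_graph E \<longleftrightarrow> (\<forall>e\<in>E. card e = 2)"

definition degree :: "'v::finite set set \<Rightarrow> 'v \<Rightarrow> nat" where
  "degree E v = card {e \<in> E. v \<in> e}"

definition adjacency_matrix :: "'v::finite set set \<Rightarrow> real ^ 'v ^ 'v" where
  "adjacency_matrix E = (\<chi> i j. if {i, j} \<in> E then 1 else 0)"

definition degree_matrix :: "'v::finite set set \<Rightarrow> real ^ 'v ^ 'v" where
  "degree_matrix E = (\<chi> i j. if i = j then real (degree E i) else 0)"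

definition signless_laplacian :: "'v::finite set set \<Rightarrow> real ^ 'v ^ 'v" where
  "signless_laplacian E = degree_matrix E + adjacency_matrix E"

definition eigenvalue :: "real ^ 'v ^ 'v \<Rightarrow> real \<Rightarrow> bool" where
  "eigenvalue A l \<longleftrightarrow> (\<exists>x. x \<noteq> 0 \<and> A *v x = l *\<^sub>R x)"

text \<open>Only applied to symmetric matrices: there all eigenvalues are real and the set below is
  finite and nonempty, so that \<open>Max\<close> is meaningful.\<close>

definition largest_eigenvalue :: "real ^ 'v ^ 'v \<Rightarrow> real" where
  "largest_eigenvalue A = Max {l. eigenvalue A l}"

definition irregularity_nu :: "'v::finite set set \<Rightarrow> real" where
  "irregularity_nu E =
     real CARD('v) * (\<Sum>i\<in>UNIV. (real (degree E i))\<^sup>2) / (4 * (real (card E))\<^sup>2)"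

text \<open>For an edge \<open>e = {i, j}\<close> the product over \<open>e\<close> below is \<open>d\<^sub>i d\<^sub>j\<close>.\<close>

definition irregularity_epsilon :: "'v::finite set set \<Rightarrow> real" where
  "irregularity_epsilon E =
     real CARD('v) * (\<Sum>e\<in>E. sqrt (\<Prod>i\<in>e. real (degree E i))) / (2 * (real (card E))\<^sup>2)"

definition irregularity_gamma :: "'v::finite set set \<Rightarrow> real" where
  "irregularity_gamma E =
     largest_eigenvalue (signless_laplacian E) * real CARD('v) / (4 * real (card E))"

end

theory Submission
  imports Defs
begin

text \<open>Double counting turns \<open>\<Sum>\<^sub>i d\<^sub>i\<^sup>2\<close> into the sum of \<open>d\<^sub>i + d\<^sub>j\<close> over the edges, so the first
  inequality is AM-GM on each edge. For the second, the quadratic form of the signless Laplacian at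
  the degree vector \<open>d\<close> is \<open>\<Sum>\<^sub>e (d\<^sub>i + d\<^sub>j)\<^sup>2 \<ge> (\<Sum>\<^sub>e (d\<^sub>i + d\<^sub>j))\<^sup>2 / m = \<parallel>d\<parallel>\<^sup>4 / m\<close>, and it is at most
  \<open>q \<parallel>d\<parallel>\<^sup>2\<close> by the Rayleigh principle; hence \<open>q \<ge> \<parallel>d\<parallel>\<^sup>2 / m\<close>.\<close>

lemma inner_matrix_vector_symmetric:
  fixes A :: "real ^ 'n ^ 'n"
  assumes "transpose A = A"
  shows "inner (A *v x) y = inner x (A *v y)"
  by (metis assms dot_lmul_matrix transpose_matrix_vector)

text \<open>Eigenvectors for distinct eigenvalues are orthogonal, hence independent, and the space
  is finite-dimensional. Finiteness is what lets \<open>Max\<close> in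
  \<open>largest_eigenvalue\<close> bound every eigenvalue.\<close>

lemma finite_eigenvalues_symmetric:
  fixes A :: "real ^ 'n ^ 'n"
  assumes "transpose A = A"
  shows "finite {l. eigenvalue A l}"
proof -
  let ?S = "{l. eigenvalue A l}"
  have "\<forall>l\<in>?S. \<exists>x. x \<noteq> 0 \<and> A *v x = l *\<^sub>R x"
    by (simp add: eigenvalue_def)
  from bchoice[OF this] obtain v where v: "\<And>l. l \<in> ?S \<Longrightarrow> v l \<noteq> 0 \<and> A *v v l = l *\<^sub>R v l"
    by blast
  have orth: "inner (v k) (v l) = 0" if "k \<in> ?S" "l \<in> ?S" "k \<noteq> l" for k l
  proof -
    have "k * inner (v k) (v l) = l * inner (v k) (v l)"
      using inner_matrix_vector_symmetric[OF assms, of "v k" "v l"] v that by simp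
    with \<open>k \<noteq> l\<close> show ?thesis by simp
  qed
  have "inj_on v ?S"
    by (rule inj_onI) (metis orth v inner_eq_zero_iff)
  moreover have "pairwise orthogonal (v ` ?S)"
    using orth by (force simp: pairwise_def orthogonal_def)
  then have "finite (v ` ?S)"
    using v by (intro independent_imp_finite pairwise_orthogonal_independent) auto
  ultimately show ?thesis by (simp add: finite_image_iff)
qed

text \<open>A maximiser \<open>u\<close> of the quadratic form on the unit sphere is an eigenvector: otherwise
  moving from \<open>u\<close> along the residual \<open>w = A u - M u\<close> would increase the Rayleigh quotient.\<close>

lemma ex_eigenvalue_bounding_quadratic_form:
  fixes A :: "real ^ 'n ^ 'n"
  assumes "transpose A = A"
  shows "\<exists>M. eigenvalue A M \<and> (\<forall>x. inner x (A *v x) \<le> M * inner x x)"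
proof -
  have "continuous_on (sphere 0 1) (\<lambda>x. inner x (A *v x))"
    by (intro continuous_intros matrix_vector_mult_linear_continuous_on)
  moreover have "sphere (0 :: real ^ 'n) 1 \<noteq> {}" by simp
  ultimately obtain u where u: "norm u = 1"
    and max: "\<And>y. norm y = 1 \<Longrightarrow> inner y (A *v y) \<le> inner u (A *v u)"
    using continuous_attains_sup[of "sphere 0 1" "\<lambda>x. inner x (A *v x)"] by auto
  define M where "M = inner u (A *v u)"
  \<comment> \<open>Both sides are homogeneous of degree 2, so maximality on the unit sphere extends
    to all vectors.\<close>
  have bound: "inner x (A *v x) \<le> M * inner x x" for x
  proof (cases "x = 0")
    case False
    then have "inner (x /\<^sub>R norm x) (A *v (x /\<^sub>R norm x)) \<le> M"
      unfolding M_def by (intro max) simp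
    then have "inner x (A *v x) / (norm x)\<^sup>2 \<le> M"
      by (simp add: matrix_vector_mult_scaleR power2_eq_square field_simps)
    then show ?thesis
      using False by (simp add: divide_le_eq power2_norm_eq_inner)
  qed simp
  define w where "w = A *v u - M *\<^sub>R u"
  have uu: "inner u u = 1" using u by (simp add: norm_eq_1)
  have ww: "inner w w = inner w (A *v u) - M * inner w u"
    by (simp add: w_def inner_diff_right)
  define c where "c = M * inner w w - inner w (A *v w)"
  \<comment> \<open>This is \<open>bound\<close> at \<open>u + t w\<close>: the constant terms
    cancel, and by \<open>ww\<close> the linear terms combine to
    \<open>2 * t * inner w w\<close>.\<close>
  have quad: "2 * t * inner w w \<le> t\<^sup>2 * c" for t
  proof -
    have "inner u (A *v w) = inner w (A *v u)"
      using inner_matrix_vector_symmetric[OF assms, of u w] by (simp add: inner_commute)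
    then have form: "inner (u + t *\<^sub>R w) (A *v (u + t *\<^sub>R w))
        = M + 2 * t * inner w (A *v u) + t\<^sup>2 * inner w (A *v w)"
      by (simp add: matrix_vector_right_distrib matrix_vector_mult_scaleR M_def
          power2_eq_square algebra_simps)
    have norm: "inner (u + t *\<^sub>R w) (u + t *\<^sub>R w) = 1 + 2 * t * inner w u + t\<^sup>2 * inner w w"
      by (simp add: uu inner_commute[of u w] power2_eq_square algebra_simps)
    from bound[of "u + t *\<^sub>R w"] show ?thesis
      unfolding form norm c_def by (simp add: ww algebra_simps)
  qed
  have "w = 0"
  proof (rule ccontr)
    assume "w \<noteq> 0"
    then have pos: "inner w w > 0" by simp
    \<comment> \<open>At \<open>t = 1\<close>, \<open>quad\<close> gives
      \<open>c \<ge> 2 * inner w w > 0\<close>. Then \<open>t = inner w w / c\<close>, the minimiser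
      of \<open>t\<^sup>2 * c - 2 * t * inner w w\<close>, makes that difference negative.\<close>
    have "c > 0" using quad[of 1] pos unfolding one_power2 by linarith
    then have "2 * inner w w * inner w w \<le> inner w w * inner w w"
      using quad[of "inner w w / c"] by (simp add: power2_eq_square field_simps)
    with mult_pos_pos[OF pos pos] show False by linarith
  qed
  then have "A *v u = M *\<^sub>R u" by (simp add: w_def)
  moreover have "u \<noteq> 0" using u by auto
  ultimately show ?thesis using bound by (auto simp: eigenvalue_def)
qed

lemma quadratic_form_le_largest_eigenvalue:
  fixes A :: "real ^ 'n ^ 'n"
  assumes "transpose A = A"
  shows "inner x (A *v x) \<le> largest_eigenvalue A * inner x x"
proof -
  obtain M where M: "eigenvalue A M" "inner x (A *v x) \<le> M * inner x x"
    using ex_eigenvalue_bounding_quadratic_form[OF assms] by blast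
  have "M \<le> largest_eigenvalue A"
    unfolding largest_eigenvalue_def
    using M(1) by (intro Max_ge finite_eigenvalues_symmetric[OF assms]) simp
  then have "M * inner x x \<le> largest_eigenvalue A * inner x x"
    by (rule mult_right_mono) simp
  with M(2) show ?thesis by linarith
qed

text \<open>Both sides count the incident pairs of a vertex \<open>i\<close> and an edge
  \<open>e\<close> with weight \<open>f i\<close>. Taking \<open>f\<close> to be the degree yields
  the sum of squared degrees.\<close>

lemma sum_degree_mult:
  fixes E :: "'v::finite set set" and f :: "'v \<Rightarrow> real"
  shows "(\<Sum>i\<in>UNIV. real (degree E i) * f i) = (\<Sum>e\<in>E. \<Sum>i\<in>e. f i)"
proof -
  have "(\<Sum>e\<in>E. \<Sum>i\<in>e. f i) = (\<Sum>e\<in>E. \<Sum>i\<in>UNIV. if i \<in> e then f i else 0)"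
    by (simp add: sum.If_cases)
  also have "\<dots> = (\<Sum>i\<in>UNIV. \<Sum>e\<in>E. if i \<in> e then f i else 0)"
    by (rule sum.swap)
  also have "\<dots> = (\<Sum>i\<in>UNIV. real (degree E i) * f i)"
    by (simp add: sum.If_cases degree_def Int_def)
  finally show ?thesis by simp
qed

text \<open>This is the factorisation of the matrix as the incidence matrix times its transpose, in
  a form that treats diagonal and off-diagonal entries alike.\<close>

lemma signless_laplacian_entry:
  assumes "simple_graph E"
  shows "signless_laplacian E $ i $ j = real (card {e \<in> E. i \<in> e \<and> j \<in> e})"
proof (cases "i = j")
  case True
  \<comment> \<open>For \<open>i = j\<close> the set \<open>{i, j}\<close> collapses to a singleton,
    which is never an edge, so the adjacency matrix contributes 0.\<close>
  moreover have "{j} \<notin> E" using assms by (auto simp: simple_graph_def)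
  ultimately show ?thesis
    by (simp add: signless_laplacian_def degree_matrix_def adjacency_matrix_def degree_def)
next
  case False
  have "e = {i, j}" if "e \<in> E" "i \<in> e" "j \<in> e" for e
    using card_subset_eq[of e "{i, j}"] that False assms by (auto simp: simple_graph_def)
  then have "{e \<in> E. i \<in> e \<and> j \<in> e} = {e \<in> E. e = {i, j}}"
    by blast
  also have "\<dots> = (if {i, j} \<in> E then {{i, j}} else {})"
    by auto
  finally show ?thesis
    using False by (simp add: signless_laplacian_def degree_matrix_def adjacency_matrix_def)
qed

lemma transpose_signless_laplacian: "transpose (signless_laplacian E) = signless_laplacian E"
  by (simp add: vec_eq_iff transpose_def signless_laplacian_def degree_matrix_def
      adjacency_matrix_def insert_commute)

text \<open>Expanding each square and summing over edges first, the coefficient of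
  \<open>x $ i * x $ j\<close> is the number of edges containing both \<open>i\<close> and
  \<open>j\<close>, which is the matrix entry.\<close>

lemma quadratic_form_signless_laplacian:
  assumes "simple_graph E"
  shows "inner x (signless_laplacian E *v x) = (\<Sum>e\<in>E. (\<Sum>i\<in>e. x $ i)\<^sup>2)"
proof -
  have "(\<Sum>e\<in>E. (\<Sum>i\<in>e. x $ i)\<^sup>2)
      = (\<Sum>e\<in>E. \<Sum>i\<in>UNIV. \<Sum>j\<in>UNIV. if i \<in> e \<and> j \<in> e then x $ i * x $ j else 0)"
  proof (rule sum.cong)
    fix e
    have "(\<Sum>i\<in>e. x $ i) = (\<Sum>i\<in>UNIV. if i \<in> e then x $ i else 0)"
      by (simp add: sum.If_cases)
    then show "(\<Sum>i\<in>e. x $ i)\<^sup>2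
        = (\<Sum>i\<in>UNIV. \<Sum>j\<in>UNIV. if i \<in> e \<and> j \<in> e then x $ i * x $ j else 0)"
      by (simp only: power2_eq_square sum_product) (intro sum.cong; simp)
  qed simp
  also have "\<dots> = (\<Sum>i\<in>UNIV. \<Sum>j\<in>UNIV. \<Sum>e\<in>E. if i \<in> e \<and> j \<in> e then x $ i * x $ j else 0)"
    by (subst sum.swap) (intro sum.cong refl sum.swap)
  also have "\<dots> = (\<Sum>i\<in>UNIV. \<Sum>j\<in>UNIV. signless_laplacian E $ i $ j * (x $ i * x $ j))"
    by (simp add: signless_laplacian_entry[OF assms] sum.If_cases Int_def)
  also have "\<dots> = inner x (signless_laplacian E *v x)"
    by (simp add: inner_vec_def matrix_vector_mult_def sum_distrib_left mult_ac)
  finally show ?thesis by simp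
qed

lemma sum_sqrt_degree_products_le:
  assumes "simple_graph E"
  shows "2 * (\<Sum>e\<in>E. sqrt (\<Prod>i\<in>e. real (degree E i))) \<le> (\<Sum>i\<in>UNIV. (real (degree E i))\<^sup>2)"
proof -
  have "2 * sqrt (\<Prod>i\<in>e. real (degree E i)) \<le> (\<Sum>i\<in>e. real (degree E i))" if "e \<in> E" for e
  proof -
    have "card e = 2" using assms that by (simp add: simple_graph_def)
    then obtain a b where "e = {a, b}" "a \<noteq> b"
      unfolding card_2_iff by blast
    then show ?thesis
      using arith_geo_mean_sqrt[of "real (degree E a)" "real (degree E b)"] by simp
  qed
  then have "2 * (\<Sum>e\<in>E. sqrt (\<Prod>i\<in>e. real (degree E i))) \<le> (\<Sum>e\<in>E. \<Sum>i\<in>e. real (degree E i))"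
    by (simp add: sum_distrib_left sum_mono)
  then show ?thesis
    using sum_degree_mult[of E "\<lambda>i. real (degree E i)"] by (simp add: power2_eq_square)
qed

lemma sum_degree_squares_le_largest_eigenvalue:
  fixes E :: "'v::finite set set"
  assumes "simple_graph E" and "card E \<ge> 1"
  shows "(\<Sum>i\<in>UNIV. (real (degree E i))\<^sup>2)
    \<le> largest_eigenvalue (signless_laplacian E) * real (card E)"
proof -
  let ?q = "largest_eigenvalue (signless_laplacian E)"
  define d :: "real ^ 'v" where "d = (\<chi> i. real (degree E i))"
  define S where "S = (\<Sum>i\<in>UNIV. (real (degree E i))\<^sup>2)"
  have dd: "inner d d = S"
    by (simp add: d_def S_def inner_vec_def power2_eq_square)
  have S_edges: "S = (\<Sum>e\<in>E. \<Sum>i\<in>e. d $ i)"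
    using sum_degree_mult[of E "\<lambda>i. d $ i"] by (simp add: S_def d_def power2_eq_square)
  \<comment> \<open>Cauchy-Schwarz over the edges, against the constant 1.\<close>
  have "S\<^sup>2 \<le> (\<Sum>e\<in>E. (\<Sum>i\<in>e. d $ i)\<^sup>2) * card E"
    unfolding S_edges by (rule sum_squared_le_sum_of_squares)
  also have "\<dots> \<le> ?q * S * card E"
    using quadratic_form_le_largest_eigenvalue[OF transpose_signless_laplacian, of d E]
    by (intro mult_right_mono) (simp_all add: quadratic_form_signless_laplacian[OF assms(1)] dd)
  finally have "S * S \<le> S * (?q * card E)"
    by (simp add: power2_eq_square mult_ac)
  \<comment> \<open>Positivity allows one factor \<open>S\<close> to be cancelled; an endpoint of
    any edge has positive degree.\<close>
  moreover have "S > 0"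
  proof -
    obtain e where "e \<in> E" using assms(2) by fastforce
    then obtain v where v: "v \<in> e" using assms(1) by (fastforce simp: simple_graph_def)
    with \<open>e \<in> E\<close> have "degree E v > 0" by (auto simp: degree_def card_gt_0_iff)
    then show ?thesis unfolding S_def by (intro sum_pos2[of _ v]) auto
  qed
  ultimately show ?thesis by (simp add: S_def)
qed

theorem mainTheorem8:
  fixes E :: "'v::finite set set"
  assumes "simple_graph E"
    and "card E \<ge> 1"
  shows "irregularity_nu E \<ge> irregularity_epsilon E \<and> irregularity_gamma E \<ge> irregularity_nu E"
proof
  have m: "real (card E) > 0" using assms(2) by simp
  \<comment> \<open>The fraction is expanded by 2 to share the denominator of
    \<open>irregularity_nu\<close>.\<close>
  have "irregularity_epsilon E
      = real CARD('v) * (2 * (\<Sum>e\<in>E. sqrt (\<Prod>i\<in>e. real (degree E i)))) / (4 * (real (card E))\<^sup>2)"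
    by (simp add: irregularity_epsilon_def field_simps)
  also have "\<dots> \<le> irregularity_nu E"
    unfolding irregularity_nu_def
    by (intro divide_right_mono mult_left_mono sum_sqrt_degree_products_le assms) auto
  finally show "irregularity_nu E \<ge> irregularity_epsilon E" .
  have "irregularity_nu E \<le> real CARD('v)
      * (largest_eigenvalue (signless_laplacian E) * real (card E)) / (4 * (real (card E))\<^sup>2)"
    unfolding irregularity_nu_def
    by (intro divide_right_mono mult_left_mono sum_degree_squares_le_largest_eigenvalue assms) auto
  also have "\<dots> = irregularity_gamma E"
    using m by (simp add: irregularity_gamma_def power2_eq_square field_simps)
  finally show "irregularity_gamma E \<ge> irregularity_nu E" .
qed

end
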